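(* Let $\mu$ be a monotone measure on $(X,\mathcal{A})$, let $\triangledown\colon\mu(\mathcal{A})\times\mu(\mathcal{A})\to\mu(\mathcal{A})$, let $\circ$ be an admissible fusion map that is continuous in the first argument, let $\mathrm{P}$ be the operation $x\,\mathrm{P}\,y=x$, and let $f,g\colon X\to Y$ be measurable. Assume that for each $\odot\in\{\circ,\mathrm{P}\}$, $$\big[((a+b)\wedge\bar y)\odot((c+d)\wedge\bar y)\big]\vee(\alpha\,\triangledown\,\beta)\le\big[(a\odot c)\vee\alpha\big]+\big[(b\odot d)\vee\beta\big]$$ for all $a,b,c,d\in Y$ and $\alpha,\beta\in\mu(\mathcal{A})$ such that $a+b,\,c+d\in Y$. If $f,g$ are $\mu$-$\triangledown$-subadditive and $f+g$ takes values in $Y$, then for all $n\ge1$ $$\mathrm{Su}^{\circ}_{n}(\mu,f+g)\le\mathrm{Su}^{\circ}_{n}(\mu,f)+\mathrm{Su}^{\circ}_{n}(\mu,g).\qquad( * )$$ Moreover, if $\mu(X)\le\bar y$, $\bar y\circ b\ge b$ for all $b\in Y$, and there is some $n\ge1$ such that $( * )$ holds for all measurable $f,g\colon X\to Y$ with $f+g$ taking values in $Y$, then $\mu$ is subadditive, i.e. $\mu(A\cup B)\le\mu(A)+\mu(B)$ for all $A,B\in\mathcal{A}$.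
   Context: $(X,\mathcal{A})$ is a measurable space with $X\neq\emptyset$ ($\mathcal{A}$ a $\sigma$-algebra), and $Y=[0,\bar y]$ with $0<\bar y\le\infty$. Notation: $a\wedge b=\min(a,b)$, $a\vee b=\max(a,b)$, $\{f\ge t\}=\{x\in X: f(x)\ge t\}$ and similarly $\{f>t\}$; $\mu(\mathcal{A})$ is the range of $\mu$. A monotone measure on $(X,\mathcal{A})$ is a set function $\mu\colon\mathcal{A}\to[0,\infty]$ with $\mu(A)\le\mu(B)$ whenever $A\subset B$, $\mu(\emptyset)=0$ and $\mu(X)>0$. Functions $f,g$ are $\mu$-$\triangledown$-subadditive if $\mu(\{f>a\}\cup\{g>b\})\le\mu(\{f>a\})\,\triangledown\,\mu(\{g>b\})$ for all $a,b\in Y$. An admissible fusion map is a nondecreasing map $\circ\colon Y\times Y\to Y$ (i.e. $a_1\circ a_2\le b_1\circ b_2$ whenever $a_i\le b_i$) such that $0\circ a\le a$ for all $a\in Y$. The upper $n$-Sugeno integral of a measurable $f\colon X\to Y$ is defined recursively by $$\mathrm{Su}^{\circ}_{1}(\mu,f)=\sup_{t\in Y}\{t\wedge\mu(\{f\ge t\})\},\qquad \mathrm{Su}^{\circ}_{n+1}(\mu,f)=\sup_{t\in Y}\big\{(t\circ\mathrm{Su}^{\circ}_{n}(\mu,f))\wedge\mu(\{f\ge t\})\big\}.$$ *)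

theory Defs
  imports "HOL-Analysis.Analysis"
begin

text \<open>
  The interval \<open>Y = [0, ybar]\<close>, where \<open>ybar = \<infinity>\<close> is allowed, is rendered as the
  subset \<open>{0..ybar}\<close> of \<^typ>\<open>ennreal\<close>.  Binary operations on \<open>Y\<close> (or on the range of \<open>mu\<close>)
  are total functions on \<^typ>\<open>ennreal\<close>, constrained only on that set.  The measurable space
  is given by \<open>space M\<close> and \<open>sets M\<close>; the measure carried by \<open>M\<close> is never used, since
  a monotone measure \<open>mu\<close> need not be additive.
\<close>

definition monotone_measure :: "'a measure \<Rightarrow> ('a set \<Rightarrow> ennreal) \<Rightarrow> bool" where
  "monotone_measure M mu \<longleftrightarrow>
     (\<forall>A\<in>sets M. \<forall>B\<in>sets M. A \<subseteq> B \<longrightarrow> mu A \<le> mu B) \<and> mu {} = 0 \<and> mu (space M) > 0"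

definition tri_subadditive ::
  "'a measure \<Rightarrow> ('a set \<Rightarrow> ennreal) \<Rightarrow> ennreal \<Rightarrow> (ennreal \<Rightarrow> ennreal \<Rightarrow> ennreal)
    \<Rightarrow> ('a \<Rightarrow> ennreal) \<Rightarrow> ('a \<Rightarrow> ennreal) \<Rightarrow> bool" where
  "tri_subadditive M mu ybar tri f g \<longleftrightarrow>
     (\<forall>a\<in>{0..ybar}. \<forall>b\<in>{0..ybar}.
        mu ({x\<in>space M. f x > a} \<union> {x\<in>space M. g x > b})
          \<le> tri (mu {x\<in>space M. f x > a}) (mu {x\<in>space M. g x > b}))"

definition admissible_fusion :: "ennreal \<Rightarrow> (ennreal \<Rightarrow> ennreal \<Rightarrow> ennreal) \<Rightarrow> bool" where
  "admissible_fusion ybar circ \<longleftrightarrow>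
     (\<forall>a\<in>{0..ybar}. \<forall>b\<in>{0..ybar}. circ a b \<in> {0..ybar}) \<and>
     (\<forall>a1\<in>{0..ybar}. \<forall>a2\<in>{0..ybar}. \<forall>b1\<in>{0..ybar}. \<forall>b2\<in>{0..ybar}.
        a1 \<le> b1 \<longrightarrow> a2 \<le> b2 \<longrightarrow> circ a1 a2 \<le> circ b1 b2) \<and>
     (\<forall>a\<in>{0..ybar}. circ 0 a \<le> a)"

text \<open>The integral is indexed from 1; the value at 0 is a dummy.\<close>

fun upper_sugeno ::
  "'a measure \<Rightarrow> ('a set \<Rightarrow> ennreal) \<Rightarrow> ennreal \<Rightarrow> (ennreal \<Rightarrow> ennreal \<Rightarrow> ennreal)
    \<Rightarrow> nat \<Rightarrow> ('a \<Rightarrow> ennreal) \<Rightarrow> ennreal" where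
  "upper_sugeno M mu ybar circ 0 f = 0"
| "upper_sugeno M mu ybar circ (Suc 0) f =
     (SUP t\<in>{0..ybar}. min t (mu {x\<in>space M. f x \<ge> t}))"
| "upper_sugeno M mu ybar circ (Suc (Suc n)) f =
     (SUP t\<in>{0..ybar}.
        min (circ t (upper_sugeno M mu ybar circ (Suc n) f)) (mu {x\<in>space M. f x \<ge> t}))"

end

theory Submission
  imports Defs
begin

text \<open>
  Both halves rest on viewing one step of the recursion as a Sugeno-type integral
  \<open>SUP t. min (h t) (mu {f \<ge> t})\<close>, with \<open>h t = t\<close> in the first step and
  \<open>h t = circ t (Su\<^sub>n f)\<close> in the later ones.

  For the subadditivity of the integrals, this supremum has to be bounded from above, for
  \<open>f + g\<close>, and from below, for \<open>f\<close> and \<open>g\<close>.  The dual formula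
  \<open>SUP t. min (h t) (mu {f \<ge> t}) = INF t. max (h t) (mu {f > t})\<close>
  turns both tasks into one comparison of single terms.  Its nontrivial half
  (\<open>INF_max_le_sugeno_step\<close>) rests on the continuity of \<open>circ\<close> in the first argument, through
  the intermediate value theorem, and on \<open>circ 0 a \<le> a\<close>, which gives \<open>h 0 \<le> mu (space M)\<close>
  because the integrals never exceed \<open>mu (space M)\<close>.  With the dual formula at hand,
  \<open>{f + g > a + b} \<subseteq> {f > a} \<union> {g > b}\<close>, the \<open>tri\<close>-subadditivity and the assumed inequality give
  the bound for each pair of levels \<open>a\<close>, \<open>b\<close> (\<open>sugeno_step_add_le\<close>).  The assumed inequality
  speaks only of sums that stay in \<open>[0, ybar]\<close>; monotonicity of the operation removes this
  restriction (\<open>balance_extends\<close>).  Induction on \<open>n\<close> then chains the steps.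

  Conversely, all the integrals of the function that equals \<open>ybar\<close> on \<open>A\<close> and \<open>0\<close> elsewhere
  return \<open>mu A\<close> (\<open>upper_sugeno_scaled_indicator\<close>).  Applying the integral inequality to \<open>A\<close> and
  the disjoint set \<open>B - A\<close> gives the subadditivity of \<open>mu\<close>.
\<close>

definition sugeno_step ::
  "'a measure \<Rightarrow> ('a set \<Rightarrow> ennreal) \<Rightarrow> ennreal \<Rightarrow> (ennreal \<Rightarrow> ennreal) \<Rightarrow> ('a \<Rightarrow> ennreal) \<Rightarrow> ennreal"
  where "sugeno_step M mu ybar h f = (SUP t\<in>{0..ybar}. min (h t) (mu {x\<in>space M. f x \<ge> t}))"

lemma upper_sugeno_1: "upper_sugeno M mu ybar circ (Suc 0) f = sugeno_step M mu ybar (\<lambda>t. t) f"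
  by (simp add: sugeno_step_def)

lemma upper_sugeno_Suc:
  "upper_sugeno M mu ybar circ (Suc (Suc n)) f =
     sugeno_step M mu ybar (\<lambda>t. circ t (upper_sugeno M mu ybar circ (Suc n) f)) f"
  by (simp add: sugeno_step_def)

lemma monotone_measure_mono:
  assumes "monotone_measure M mu" "A \<in> sets M" "B \<in> sets M" "A \<subseteq> B"
  shows "mu A \<le> mu B"
  using assms unfolding monotone_measure_def by blast

section \<open>The dual formula\<close>

text \<open>
  Levels up to \<open>t\<close> are controlled by monotonicity of \<open>h\<close>, levels above \<open>t\<close> by
  \<open>{f \<ge> s} \<subseteq> {f > t}\<close>.
\<close>

lemma sugeno_step_le_max:
  assumes mm: "monotone_measure M mu"
    and f[measurable]: "f \<in> borel_measurable M"
    and mono: "\<And>s t. s \<le> t \<Longrightarrow> t \<le> ybar \<Longrightarrow> h s \<le> h t"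
    and t: "t \<le> ybar"
  shows "sugeno_step M mu ybar h f \<le> max (h t) (mu {x\<in>space M. f x > t})"
  unfolding sugeno_step_def
proof (rule SUP_least)
  fix s assume s: "s \<in> {0..ybar}"
  show "min (h s) (mu {x\<in>space M. f x \<ge> s}) \<le> max (h t) (mu {x\<in>space M. f x > t})"
  proof (cases "s \<le> t")
    case True
    then show ?thesis using mono t by (meson min.coboundedI1 max.coboundedI1)
  next
    case False
    then have "mu {x\<in>space M. f x \<ge> s} \<le> mu {x\<in>space M. f x > t}"
      by (intro monotone_measure_mono[OF mm]) auto
    then show ?thesis by (meson min.coboundedI2 max.coboundedI2)
  qed
qed

text \<open>
  If the inequality failed, a value \<open>c\<close> would lie strictly between the two sides.  The endpoints
  satisfy \<open>h 0 < c < h ybar\<close>: since \<open>h 0 \<le> mu {f \<ge> 0}\<close>, the value \<open>h 0\<close> is a term of the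
  supremum, and since \<open>{f > ybar}\<close> is empty, \<open>h ybar\<close> is a term of the infimum.  At a level \<open>t\<close> with
  \<open>h t = c\<close>, the infimum forces \<open>mu {f > t} > c\<close>, so the supremum is at least \<open>c\<close>.
\<close>

lemma INF_max_le_sugeno_step:
  assumes mm: "monotone_measure M mu"
    and f[measurable]: "f \<in> borel_measurable M"
    and bounded: "\<And>x. x \<in> space M \<Longrightarrow> f x \<le> ybar"
    and cont: "continuous_on {0..ybar} h"
    and h0: "h 0 \<le> mu (space M)"
  shows "(INF t\<in>{0..ybar}. max (h t) (mu {x\<in>space M. f x > t})) \<le> sugeno_step M mu ybar h f"
    (is "?I \<le> ?S")
proof (rule ccontr)
  assume "\<not> ?I \<le> ?S"
  then obtain c where c: "?S < c" "c < ?I"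
    using dense[of ?S ?I] by (auto simp: not_le)
  have S_ge: "min (h t) (mu {x\<in>space M. f x \<ge> t}) \<le> ?S" if "t \<le> ybar" for t
    unfolding sugeno_step_def using that by (intro SUP_upper) auto
  have I_le: "?I \<le> max (h t) (mu {x\<in>space M. f x > t})" if "t \<le> ybar" for t
    using that by (intro INF_lower) auto
  have "h 0 \<le> ?S"
    using S_ge[of 0] h0 by (simp add: min_def split: if_splits)
  then have "h 0 \<le> c" using c by simp
  moreover have "{x\<in>space M. f x > ybar} = {}"
    using bounded by (auto simp: not_less)
  then have "mu {x\<in>space M. f x > ybar} = 0"
    using mm unfolding monotone_measure_def by (simp only:)
  then have "?I \<le> h ybar"
    using I_le[of ybar] by (simp add: max.absorb1)
  then have "c \<le> h ybar" using c by simp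
  ultimately obtain t where t: "t \<le> ybar" "h t = c"
    using IVT'[of h 0 c ybar] cont by auto
  have "c < mu {x\<in>space M. f x > t}"
    using I_le[OF t(1)] c(2) t(2) by (auto simp: max_def split: if_splits)
  also have "\<dots> \<le> mu {x\<in>space M. f x \<ge> t}"
    by (intro monotone_measure_mono[OF mm]) auto
  finally have "c \<le> ?S"
    using S_ge[OF t(1)] t(2) by simp
  then show False using c by simp
qed

section \<open>Subadditivity of one step\<close>

lemma shrink_to_sum_le:
  fixes a b y :: ennreal
  assumes "a \<le> y" "b \<le> y"
  obtains a' b' where "a' \<le> a" "b' \<le> b" "a' + b' = min (a + b) y"
proof (cases "a + b \<le> y")
  case True
  then show ?thesis using that[of a b] by simp
next
  case False
  have "a + (y - a) = y" using assms by (simp add: add_diff_inverse_ennreal)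
  moreover from this False have "y - a \<le> b"
    by (metis add_left_mono linear)
  ultimately show ?thesis using that[of a "y - a"] False by simp
qed

text \<open>
  If a sum exceeds \<open>ybar\<close>, its summands can be decreased until the sum is exactly \<open>ybar\<close>: the
  left-hand side, which truncates the sums at \<open>ybar\<close>, is unchanged, and the right-hand side
  can only decrease.
\<close>

lemma balance_extends:
  fixes P :: "ennreal \<Rightarrow> ennreal \<Rightarrow> ennreal"
  assumes mono: "\<And>a b c d. a \<le> b \<Longrightarrow> b \<le> ybar \<Longrightarrow> c \<le> d \<Longrightarrow> d \<le> ybar \<Longrightarrow> P a c \<le> P b d"
    and balance: "\<And>a b c d. a \<le> ybar \<Longrightarrow> b \<le> ybar \<Longrightarrow> c \<le> ybar \<Longrightarrow> d \<le> ybar \<Longrightarrow>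
        a + b \<le> ybar \<Longrightarrow> c + d \<le> ybar \<Longrightarrow>
        max (P (min (a + b) ybar) (min (c + d) ybar)) \<gamma> \<le> max (P a c) \<alpha> + max (P b d) \<beta>"
    and le: "a \<le> ybar" "b \<le> ybar" "c \<le> ybar" "d \<le> ybar"
  shows "max (P (min (a + b) ybar) (min (c + d) ybar)) \<gamma> \<le> max (P a c) \<alpha> + max (P b d) \<beta>"
proof -
  obtain a' b' where ab: "a' \<le> a" "b' \<le> b" "a' + b' = min (a + b) ybar"
    using shrink_to_sum_le le by metis
  obtain c' d' where cd: "c' \<le> c" "d' \<le> d" "c' + d' = min (c + d) ybar"
    using shrink_to_sum_le le by metis
  have "max (P (min (a' + b') ybar) (min (c' + d') ybar)) \<gamma> \<le> max (P a' c') \<alpha> + max (P b' d') \<beta>"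
    using ab cd order_trans[OF ab(1) le(1)] order_trans[OF ab(2) le(2)]
      order_trans[OF cd(1) le(3)] order_trans[OF cd(2) le(4)]
    by (intro balance) simp_all
  also have "\<dots> \<le> max (P a c) \<alpha> + max (P b d) \<beta>"
    using ab cd le by (intro add_mono max.mono mono) auto
  finally show ?thesis using ab cd by simp
qed

lemma INF_add_const_ennreal:
  fixes f :: "'b \<Rightarrow> ennreal"
  assumes "I \<noteq> {}"
  shows "(INF i\<in>I. f i + c) = (INF i\<in>I. f i) + c"
  using continuous_at_Inf_mono[of "\<lambda>x. x + c" "f ` I"] assms
    continuous_add[of "at_right (Inf (f ` I))" "\<lambda>x. x" "\<lambda>x. c"]
  by (auto simp: mono_def image_comp)

text \<open>
  Here \<open>c\<close>, \<open>d\<close> and \<open>e\<close> stand for the previous integrals of \<open>f\<close>, \<open>g\<close> and \<open>f + g\<close>.  By the dual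
  formula it suffices to bound the left-hand side by
  \<open>max (P a c) (mu {f > a}) + max (P b d) (mu {g > b})\<close> for arbitrary levels \<open>a\<close> and \<open>b\<close>, and
  for this the dual formula for \<open>f + g\<close> is used at the level \<open>min (a + b) ybar\<close>.
\<close>

lemma sugeno_step_add_le:
  fixes P :: "ennreal \<Rightarrow> ennreal \<Rightarrow> ennreal"
  assumes mm: "monotone_measure M mu"
    and f[measurable]: "f \<in> borel_measurable M"
    and g[measurable]: "g \<in> borel_measurable M"
    and sum_le: "\<And>x. x \<in> space M \<Longrightarrow> f x + g x \<le> ybar"
    and tri: "tri_subadditive M mu ybar tri f g"
    and mono: "\<And>a b c d. a \<le> b \<Longrightarrow> b \<le> ybar \<Longrightarrow> c \<le> d \<Longrightarrow> d \<le> ybar \<Longrightarrow> P a c \<le> P b d"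
    and cont: "\<And>c. c \<le> ybar \<Longrightarrow> continuous_on {0..ybar} (\<lambda>t. P t c)"
    and balance: "\<And>a b c d \<alpha> \<beta>. a \<le> ybar \<Longrightarrow> b \<le> ybar \<Longrightarrow> c \<le> ybar \<Longrightarrow> d \<le> ybar \<Longrightarrow>
        \<alpha> \<in> mu ` sets M \<Longrightarrow> \<beta> \<in> mu ` sets M \<Longrightarrow> a + b \<le> ybar \<Longrightarrow> c + d \<le> ybar \<Longrightarrow>
        max (P (min (a + b) ybar) (min (c + d) ybar)) (tri \<alpha> \<beta>) \<le> max (P a c) \<alpha> + max (P b d) \<beta>"
    and c: "c \<le> ybar" "P 0 c \<le> mu (space M)"
    and d: "d \<le> ybar" "P 0 d \<le> mu (space M)"
    and e: "e \<le> c + d" "e \<le> ybar"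
  shows "sugeno_step M mu ybar (\<lambda>t. P t e) (\<lambda>x. f x + g x) \<le>
    sugeno_step M mu ybar (\<lambda>t. P t c) f + sugeno_step M mu ybar (\<lambda>t. P t d) g"
    (is "?S \<le> _")
proof -
  let ?F = "\<lambda>a. max (P a c) (mu {x\<in>space M. f x > a})"
  let ?G = "\<lambda>b. max (P b d) (mu {x\<in>space M. g x > b})"
  have levels: "?S \<le> ?F a + ?G b" if a: "a \<in> {0..ybar}" and b: "b \<in> {0..ybar}" for a b
  proof -
    let ?t = "min (a + b) ybar"
    let ?A = "{x\<in>space M. f x > a}" and ?B = "{x\<in>space M. g x > b}"
    \<comment> \<open>If \<open>a + b\<close> exceeds \<open>ybar\<close>, the set on the left is empty because \<open>f + g\<close> is at most \<open>ybar\<close>.\<close>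
    have "{x\<in>space M. f x + g x > ?t} \<subseteq> ?A \<union> ?B"
    proof
      fix x assume "x \<in> {x\<in>space M. f x + g x > ?t}"
      then have "x \<in> space M" "f x + g x > a + b"
        using sum_le by (auto simp: min_less_iff_disj not_less[symmetric])
      then show "x \<in> ?A \<union> ?B"
        using add_mono[of "f x" a "g x" b] by (auto simp: not_le[symmetric])
    qed
    then have "mu {x\<in>space M. f x + g x > ?t} \<le> mu (?A \<union> ?B)"
      by (intro monotone_measure_mono[OF mm]) auto
    also have "\<dots> \<le> tri (mu ?A) (mu ?B)"
      using tri a b unfolding tri_subadditive_def by blast
    finally have mu_le: "mu {x\<in>space M. f x + g x > ?t} \<le> tri (mu ?A) (mu ?B)" .
    have "?S \<le> max (P ?t e) (mu {x\<in>space M. f x + g x > ?t})"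
      using e by (intro sugeno_step_le_max[OF mm] mono) auto
    also have "\<dots> \<le> max (P ?t (min (c + d) ybar)) (tri (mu ?A) (mu ?B))"
      using e mu_le by (intro max.mono mono) auto
    also have "\<dots> \<le> ?F a + ?G b"
    proof (rule balance_extends[of ybar P])
      show "P a c \<le> P b d" if "a \<le> b" "b \<le> ybar" "c \<le> d" "d \<le> ybar" for a b c d
        using that by (rule mono)
      show "max (P (min (a' + b') ybar) (min (c' + d') ybar)) (tri (mu ?A) (mu ?B))
          \<le> max (P a' c') (mu ?A) + max (P b' d') (mu ?B)"
        if "a' \<le> ybar" "b' \<le> ybar" "c' \<le> ybar" "d' \<le> ybar" "a' + b' \<le> ybar" "c' + d' \<le> ybar"
        for a' b' c' d'
        using that by (intro balance imageI) measurable
    qed (use a b c d in auto)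
    finally show ?thesis .
  qed
  have "?S \<le> (INF a\<in>{0..ybar}. INF b\<in>{0..ybar}. ?F a + ?G b)"
    by (intro INF_greatest levels)
  also have "\<dots> = (INF a\<in>{0..ybar}. ?F a) + (INF b\<in>{0..ybar}. ?G b)"
    using INF_add_const_ennreal[of "{0..ybar}" ?F "INF b\<in>{0..ybar}. ?G b"]
      INF_add_const_ennreal[of "{0..ybar}" ?G "?F a" for a]
    by (simp add: add.commute)
  also have "\<dots> \<le> sugeno_step M mu ybar (\<lambda>t. P t c) f + sugeno_step M mu ybar (\<lambda>t. P t d) g"
  proof (intro add_mono INF_max_le_sugeno_step[OF mm] cont f g c d)
    fix x assume "x \<in> space M"
    then show "f x \<le> ybar" "g x \<le> ybar"
      using sum_le[of x] order_trans[of "f x" "f x + g x" ybar]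
        order_trans[of "g x" "f x + g x" ybar] by simp_all
  qed
  finally show ?thesis .
qed

section \<open>The iterated integrals\<close>

lemma upper_sugeno_le_ybar:
  assumes adm: "admissible_fusion ybar circ"
  shows "upper_sugeno M mu ybar circ n f \<le> ybar"
proof (induction n rule: induct_nat_012)
  case (ge2 n)
  have "circ t (upper_sugeno M mu ybar circ (Suc n) f) \<le> ybar" if "t \<in> {0..ybar}" for t
    using adm that ge2 unfolding admissible_fusion_def by auto
  then show ?case
    unfolding upper_sugeno.simps by (intro SUP_least) (auto intro: min.coboundedI1)
qed (auto intro!: SUP_least min.coboundedI1)

lemma sugeno_step_le_measure_space:
  assumes mm: "monotone_measure M mu" and f[measurable]: "f \<in> borel_measurable M"
  shows "sugeno_step M mu ybar h f \<le> mu (space M)"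
  unfolding sugeno_step_def
  by (intro SUP_least min.coboundedI2 monotone_measure_mono[OF mm]) auto

lemma upper_sugeno_le_measure_space:
  assumes "monotone_measure M mu" "f \<in> borel_measurable M"
  shows "upper_sugeno M mu ybar circ (Suc n) f \<le> mu (space M)"
  using sugeno_step_le_measure_space[OF assms]
  by (cases n) (simp_all only: upper_sugeno_1 upper_sugeno_Suc)

text \<open>
  At every level in \<open>(0, ybar]\<close> the superlevel set is \<open>A\<close>.  At level \<open>0\<close> it is the whole space,
  but there \<open>circ 0 a \<le> a\<close> keeps the term below the previous integral; hence no integral exceeds
  \<open>mu A\<close>.  The level \<open>ybar\<close> attains this value because \<open>mu A \<le> ybar\<close> and \<open>b \<le> circ ybar b\<close>.
\<close>

lemma upper_sugeno_scaled_indicator: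
  assumes mm: "monotone_measure M mu"
    and adm: "admissible_fusion ybar circ"
    and y: "0 < ybar" "mu (space M) \<le> ybar"
    and top: "\<And>b. b \<le> ybar \<Longrightarrow> b \<le> circ ybar b"
    and A: "A \<in> sets M"
  shows "upper_sugeno M mu ybar circ (Suc n) (\<lambda>x. if x \<in> A then ybar else 0) = mu A"
proof -
  let ?f = "\<lambda>x. if x \<in> A then ybar else 0"
  have level: "{x\<in>space M. ?f x \<ge> t} = A" if "0 < t" "t \<le> ybar" for t
    using that sets.sets_into_space[OF A] by auto
  have muA: "mu A \<le> ybar"
    using monotone_measure_mono[OF mm A sets.top] sets.sets_into_space[OF A] y by auto
  have step: "sugeno_step M mu ybar h ?f = mu A" if "h 0 \<le> mu A" "mu A \<le> h ybar" for h
  proof (rule antisym)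
    show "sugeno_step M mu ybar h ?f \<le> mu A"
      unfolding sugeno_step_def
    proof (rule SUP_least)
      fix t assume "t \<in> {0..ybar}"
      then show "min (h t) (mu {x\<in>space M. ?f x \<ge> t}) \<le> mu A"
        using that level[of t] by (cases "t = 0") (auto intro: min.coboundedI1 simp: zero_less_iff_neq_zero)
    qed
    have "mu A = min (h ybar) (mu {x\<in>space M. ?f x \<ge> ybar})"
      using that level[of ybar] y by (simp add: min_def)
    also have "\<dots> \<le> sugeno_step M mu ybar h ?f"
      unfolding sugeno_step_def by (intro SUP_upper) auto
    finally show "mu A \<le> sugeno_step M mu ybar h ?f" .
  qed
  show ?thesis
  proof (induction n)
    case 0
    show ?case unfolding upper_sugeno_1 using muA by (intro step) auto
  next
    case (Suc n)
    show ?case unfolding upper_sugeno_Suc Suc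
      using adm muA top unfolding admissible_fusion_def by (intro step) auto
  qed
qed

theorem theorem3p8:
  fixes M :: "'a measure" and mu :: "'a set \<Rightarrow> ennreal" and ybar :: ennreal
    and tri circ :: "ennreal \<Rightarrow> ennreal \<Rightarrow> ennreal"
  assumes "space M \<noteq> {}"
    and "0 < ybar"
    and "monotone_measure M mu"
    and "\<forall>\<alpha>\<in>mu ` sets M. \<forall>\<beta>\<in>mu ` sets M. tri \<alpha> \<beta> \<in> mu ` sets M"
    and "admissible_fusion ybar circ"
    and "\<forall>b\<in>{0..ybar}. continuous_on {0..ybar} (\<lambda>a. circ a b)"
    and "\<forall>op\<in>{circ, \<lambda>x y. x}.
           \<forall>a\<in>{0..ybar}. \<forall>b\<in>{0..ybar}. \<forall>c\<in>{0..ybar}. \<forall>d\<in>{0..ybar}.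
           \<forall>\<alpha>\<in>mu ` sets M. \<forall>\<beta>\<in>mu ` sets M.
             a + b \<in> {0..ybar} \<longrightarrow> c + d \<in> {0..ybar} \<longrightarrow>
             max (op (min (a + b) ybar) (min (c + d) ybar)) (tri \<alpha> \<beta>)
               \<le> max (op a c) \<alpha> + max (op b d) \<beta>"
  shows
    "(\<forall>f\<in>measurable M (restrict_space borel {0..ybar}).
      \<forall>g\<in>measurable M (restrict_space borel {0..ybar}).
        tri_subadditive M mu ybar tri f g \<longrightarrow>
        (\<forall>x\<in>space M. f x + g x \<in> {0..ybar}) \<longrightarrow>
        (\<forall>n\<ge>1. upper_sugeno M mu ybar circ n (\<lambda>x. f x + g x)
                  \<le> upper_sugeno M mu ybar circ n f + upper_sugeno M mu ybar circ n g))
     \<and>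
     (mu (space M) \<le> ybar \<longrightarrow>
      (\<forall>b\<in>{0..ybar}. b \<le> circ ybar b) \<longrightarrow>
      (\<exists>n\<ge>1. \<forall>f\<in>measurable M (restrict_space borel {0..ybar}).
              \<forall>g\<in>measurable M (restrict_space borel {0..ybar}).
                (\<forall>x\<in>space M. f x + g x \<in> {0..ybar}) \<longrightarrow>
                upper_sugeno M mu ybar circ n (\<lambda>x. f x + g x)
                  \<le> upper_sugeno M mu ybar circ n f + upper_sugeno M mu ybar circ n g) \<longrightarrow>
      (\<forall>A\<in>sets M. \<forall>B\<in>sets M. mu (A \<union> B) \<le> mu A + mu B))"
proof (intro conjI ballI impI allI)
  note mm = assms(3) and adm = assms(5) and cont = assms(6) and balance = assms(7)
  fix f g and n :: nat
  assume f: "f \<in> measurable M (restrict_space borel {0..ybar})"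
    and g: "g \<in> measurable M (restrict_space borel {0..ybar})"
    and tri: "tri_subadditive M mu ybar tri f g"
    and sum_le: "\<forall>x\<in>space M. f x + g x \<in> {0..ybar}"
    and "1 \<le> n"
  have meas: "f \<in> borel_measurable M" "g \<in> borel_measurable M"
    using f g by (auto simp: measurable_restrict_space2_iff)
  let ?S = "\<lambda>n. upper_sugeno M mu ybar circ n"
  have "?S (Suc m) (\<lambda>x. f x + g x) \<le> ?S (Suc m) f + ?S (Suc m) g" for m
  proof (induction m)
    case 0
    have bal: "max (min (a + b) ybar) (tri \<alpha> \<beta>) \<le> max a \<alpha> + max b \<beta>"
      if "a \<le> ybar" "b \<le> ybar" "a + b \<le> ybar" "\<alpha> \<in> mu ` sets M" "\<beta> \<in> mu ` sets M"
      for a b \<alpha> \<beta>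
      using balance[rule_format, of "\<lambda>x y. x" a b 0 0 \<alpha> \<beta>] that by simp
    \<comment> \<open>The operation is the projection to the first argument, so the second one is arbitrary.\<close>
    show ?case
      unfolding upper_sugeno_1
      by (rule sugeno_step_add_le[where P = "\<lambda>a c. a" and c = 0 and d = 0 and e = 0,
            OF mm meas _ tri]) (use sum_le bal in auto)
  next
    case (Suc m)
    have circ0: "circ 0 (?S (Suc m) u) \<le> mu (space M)" if "u \<in> borel_measurable M" for u
    proof -
      have "circ 0 (?S (Suc m) u) \<le> ?S (Suc m) u"
        using adm upper_sugeno_le_ybar[OF adm, of M mu "Suc m" u]
        unfolding admissible_fusion_def by (meson atLeastAtMost_iff zero_le)
      then show ?thesis
        using upper_sugeno_le_measure_space[OF mm that] by (rule order_trans)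
    qed
    have mono: "circ a c \<le> circ b d" if "a \<le> b" "b \<le> ybar" "c \<le> d" "d \<le> ybar" for a b c d
    proof -
      have "a \<in> {0..ybar}" "b \<in> {0..ybar}" "c \<in> {0..ybar}" "d \<in> {0..ybar}"
        using that by (simp_all add: order_trans[of a b] order_trans[of c d])
      then show ?thesis
        using adm that unfolding admissible_fusion_def by blast
    qed
    have bal: "max (circ (min (a + b) ybar) (min (c + d) ybar)) (tri \<alpha> \<beta>)
        \<le> max (circ a c) \<alpha> + max (circ b d) \<beta>"
      if "a \<le> ybar" "b \<le> ybar" "c \<le> ybar" "d \<le> ybar" "\<alpha> \<in> mu ` sets M" "\<beta> \<in> mu ` sets M"
        "a + b \<le> ybar" "c + d \<le> ybar" for a b c d \<alpha> \<beta>
      using balance[rule_format, of circ a b c d \<alpha> \<beta>] that by simp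
    show ?case
      unfolding upper_sugeno_Suc
    proof (rule sugeno_step_add_le[where P = circ, OF mm meas _ tri])
      show "circ 0 (?S (Suc m) f) \<le> mu (space M)" "circ 0 (?S (Suc m) g) \<le> mu (space M)"
        by (intro circ0 meas)+
      show "?S (Suc m) (\<lambda>x. f x + g x) \<le> ?S (Suc m) f + ?S (Suc m) g"
        by (rule Suc)
    qed (use sum_le cont mono bal upper_sugeno_le_ybar[OF adm] in simp_all)
  qed
  from this[of "n - 1"] \<open>1 \<le> n\<close> show "?S n (\<lambda>x. f x + g x) \<le> ?S n f + ?S n g"
    by simp
next
  note mm = assms(3) and adm = assms(5)
  fix A B
  assume y: "mu (space M) \<le> ybar" and top: "\<forall>b\<in>{0..ybar}. b \<le> circ ybar b"
    and ex: "\<exists>n\<ge>1. \<forall>f\<in>measurable M (restrict_space borel {0..ybar}).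
              \<forall>g\<in>measurable M (restrict_space borel {0..ybar}).
                (\<forall>x\<in>space M. f x + g x \<in> {0..ybar}) \<longrightarrow>
                upper_sugeno M mu ybar circ n (\<lambda>x. f x + g x)
                  \<le> upper_sugeno M mu ybar circ n f + upper_sugeno M mu ybar circ n g"
    and A: "A \<in> sets M" and B: "B \<in> sets M"
  from ex obtain n where n: "n \<ge> 1"
    and subadd: "\<And>f g. f \<in> measurable M (restrict_space borel {0..ybar}) \<Longrightarrow>
      g \<in> measurable M (restrict_space borel {0..ybar}) \<Longrightarrow>
      (\<forall>x\<in>space M. f x + g x \<in> {0..ybar}) \<Longrightarrow>
      upper_sugeno M mu ybar circ n (\<lambda>x. f x + g x)
        \<le> upper_sugeno M mu ybar circ n f + upper_sugeno M mu ybar circ n g"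
    by blast
  let ?i = "\<lambda>A x. if x \<in> A then ybar else 0"
  have int: "upper_sugeno M mu ybar circ n (?i C) = mu C" if "C \<in> sets M" for C
    using upper_sugeno_scaled_indicator[OF mm adm assms(2) y _ that, of "n - 1"] top n by simp
  have meas: "?i C \<in> measurable M (restrict_space borel {0..ybar})" if "C \<in> sets M" for C
    using that by (auto simp: measurable_restrict_space2_iff)
  \<comment> \<open>Removing \<open>A\<close> from \<open>B\<close> keeps the sum of the two functions from exceeding \<open>ybar\<close>.\<close>
  have union: "?i (A \<union> B) = (\<lambda>x. ?i A x + ?i (B - A) x)"
    by auto
  have "mu (A \<union> B) = upper_sugeno M mu ybar circ n (\<lambda>x. ?i A x + ?i (B - A) x)"
    using int[of "A \<union> B"] A B unfolding union by simp
  also have "\<dots> \<le> upper_sugeno M mu ybar circ n (?i A) + upper_sugeno M mu ybar circ n (?i (B - A))"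
    using A B by (intro subadd meas) auto
  also have "\<dots> = mu A + mu (B - A)"
    using int[of A] int[of "B - A"] A B by simp
  also have "\<dots> \<le> mu A + mu B"
    using A B by (intro add_left_mono monotone_measure_mono[OF mm]) auto
  finally show "mu (A \<union> B) \<le> mu A + mu B" .
qed

end
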